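(* Let $g:\mathbb{R}\to\mathbb{R}$ be a derivator, $\mathbb{F}\in\{\mathbb{R},\mathbb{C}\}$, $\lambda\in\mathbb{F}\setminus\{0\}$, and fix $x_0\in\mathbb{R}$. For $x\in\mathbb{R}$, the series $$\sum_{n=0}^\infty\lambda^n\frac{g_n(x)}{n!}$$ converges absolutely if and only if both series $$\sum_{n=0}^\infty\lambda^n\frac{g^C_n(x)}{n!},\qquad\sum_{n=0}^\infty\lambda^n\frac{g^B_n(x)}{n!}$$ converge absolutely. Besides, for all $x\in\Omega_{x_0}$, $$\exp_g(\lambda;x_0)(x)=\exp_{g^C}(\lambda;x_0)(x)\,\exp_{g^B}(\lambda;x_0)(x),$$ where $\Omega_{x_0}$ is the maximal interval on which $\sum_{n=0}^\infty\lambda^n\frac{g_n(x)}{n!}$ converges absolutely.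
   Context: A derivator is a left-continuous non-decreasing function $g:\mathbb{R}\to\mathbb{R}$; $\Delta g(x)=g(x^+)-g(x)$. $\mu_g$ denotes its Lebesgue–Stieltjes measure, characterized on Borel sets by $\mu_g([a,b))=g(b)-g(a)$ for $a<b$. For any derivator $h$, the $h$-monomials centered at $x_0$ are $h_{x_0,0}\equiv 1$ and, for $n\ge 1$, $h_{x_0,n}(x)=n\int_{[x_0,x)}h_{x_0,n-1}\,d\mu_h$ if $x\ge x_0$ and $h_{x_0,n}(x)=-n\int_{[x,x_0)}h_{x_0,n-1}\,d\mu_h$ if $x<x_0$. The discontinuous part of $g$ is $g^B(x)=\sum_{s\in[0,x)}\Delta g(s)$ for $x>0$ and $g^B(x)=-\sum_{s\in[x,0)}\Delta g(s)$ for $x\le 0$; the continuous part is $g^C=g-g^B$. Both are derivators. Write $g_n=g_{x_0,n}$, $g^C_n=(g^C)_{x_0,n}$, $g^B_n=(g^B)_{x_0,n}$. For a derivator $h$, $\exp_h(\lambda;x_0)(x)=\sum_{n=0}^\infty\lambda^n\frac{h_{x_0,n}(x)}{n!}$ at those points where the sum converges absolutely. *)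

theory Defs
  imports "HOL-Analysis.Analysis"
begin

definition derivator :: "(real \<Rightarrow> real) \<Rightarrow> bool" where
  "derivator g \<longleftrightarrow> mono g \<and> (\<forall>x. continuous (at_left x) g)"

definition jump :: "(real \<Rightarrow> real) \<Rightarrow> real \<Rightarrow> real" where
  "jump g x = Lim (at_right x) g - g x"

text \<open>
  The library's \<^const>\<open>interval_measure\<close> is the Stieltjes measure of a right-continuous
  function, normalised on intervals \<open>{a<..b}\<close>. The measure of a left-continuous function,
  normalised on \<open>{a..<b}\<close>, is obtained from it by reflection at the origin; the two lemmas
  below give the characterising properties.
\<close>

definition stieltjes_measure :: "(real \<Rightarrow> real) \<Rightarrow> real measure" where
  "stieltjes_measure g = distr (interval_measure (\<lambda>x. - g (- x))) borel uminus"

lemma sets_stieltjes_measure [simp]: "sets (stieltjes_measure g) = sets borel"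
  by (simp add: stieltjes_measure_def)

lemma emeasure_stieltjes_measure_Ico:
  assumes "derivator g" "a < b"
  shows "emeasure (stieltjes_measure g) {a..<b} = ennreal (g b - g a)"
proof -
  let ?F = "\<lambda>x. - g (- x)"
  have mono: "\<And>x y. x \<le> y \<Longrightarrow> ?F x \<le> ?F y"
    using assms(1) by (auto simp: derivator_def mono_def)
  have rc: "continuous (at_right x) ?F" for x
  proof -
    have "(g \<longlongrightarrow> g (- x)) (at_left (- x))"
      using assms(1) by (simp add: derivator_def continuous_within)
    then have "((\<lambda>y. g (- y)) \<longlongrightarrow> g (- x)) (at_right x)"
      by (simp add: filterlim_at_left_to_right)
    then show ?thesis
      by (auto simp: continuous_within intro: tendsto_minus)
  qed
  have pre: "uminus -` {a..<b} = {- b<..- a}"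
    by auto
  show ?thesis
    using assms(2) emeasure_interval_measure_Ioc[of "- b" "- a" ?F, OF _ mono rc]
    by (simp add: stieltjes_measure_def emeasure_distr pre)
qed

primrec monomial :: "(real \<Rightarrow> real) \<Rightarrow> real \<Rightarrow> nat \<Rightarrow> real \<Rightarrow> real" where
  "monomial h x0 0 = (\<lambda>x. 1)"
| "monomial h x0 (Suc n) = (\<lambda>x.
     if x0 \<le> x
     then real (Suc n) * (LINT t:{x0..<x}|stieltjes_measure h. monomial h x0 n t)
     else - real (Suc n) * (LINT t:{x..<x0}|stieltjes_measure h. monomial h x0 n t))"

text \<open>The sums below range over uncountable index sets, hence the unordered sum
  \<^const>\<open>infsum\<close>.\<close>

definition disc_part :: "(real \<Rightarrow> real) \<Rightarrow> real \<Rightarrow> real" where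
  "disc_part g x =
     (if x > 0 then (\<Sum>\<^sub>\<infinity>s\<in>{0..<x}. jump g s) else - (\<Sum>\<^sub>\<infinity>s\<in>{x..<0}. jump g s))"

definition cont_part :: "(real \<Rightarrow> real) \<Rightarrow> real \<Rightarrow> real" where
  "cont_part g x = g x - disc_part g x"

definition exp_term ::
    "(real \<Rightarrow> real) \<Rightarrow> 'a::{real_normed_field,banach} \<Rightarrow> real \<Rightarrow> real \<Rightarrow> nat \<Rightarrow> 'a" where
  "exp_term h c x0 x n = c ^ n * (of_real (monomial h x0 n x) / fact n)"

definition exp_series_abs_conv ::
    "(real \<Rightarrow> real) \<Rightarrow> 'a::{real_normed_field,banach} \<Rightarrow> real \<Rightarrow> real \<Rightarrow> bool" where
  "exp_series_abs_conv h c x0 x \<longleftrightarrow> summable (\<lambda>n. norm (exp_term h c x0 x n))"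

text \<open>Only meaningful at points where \<^const>\<open>exp_series_abs_conv\<close> holds.\<close>

definition gexp ::
    "(real \<Rightarrow> real) \<Rightarrow> 'a::{real_normed_field,banach} \<Rightarrow> real \<Rightarrow> real \<Rightarrow> 'a" where
  "gexp h c x0 x = (\<Sum>n. exp_term h c x0 x n)"

text \<open>The greatest interval with respect to inclusion. It exists because, for a derivator,
  the absolute values of the monomials grow with the distance from \<open>x0\<close> on either side; it
  contains \<open>x0\<close>.\<close>

definition conv_interval ::
    "(real \<Rightarrow> real) \<Rightarrow> 'a::{real_normed_field,banach} \<Rightarrow> real \<Rightarrow> real set" where
  "conv_interval h c x0 =
     (GREATEST I. is_interval I \<and> (\<forall>x\<in>I. exp_series_abs_conv h c x0 x))"

end

theory Submission imports Defs begin

text \<open>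
  Since the Stieltjes measure of \<open>g\<close> is the sum of those of its continuous part \<open>C\<close> and its
  discontinuous part \<open>B\<close>, and the former has no atoms, integration by parts produces no
  correction terms and yields the binomial formula
  \<open>g\<^sub>n / n! = (\<Sum>k\<le>n. (C\<^sub>k / k!) * (B\<^sub>n\<^sub>-\<^sub>k / (n-k)!))\<close>. Hence the exponential series of \<open>g\<close> is the
  Cauchy product of the other two. On either side of \<open>x0\<close> the sign of a monomial depends only
  on its degree, so the formula also holds for absolute values; as both series start
  with 1, the absolute terms of each are dominated by those of \<open>g\<close>.
\<close>

section \<open>Iterated integrals\<close>

text \<open>Half-open on the right on either side of \<open>x0\<close>, like the domains in
  \<open>monomial\<close>; thus \<open>x\<close> itself belongs to it exactly when
  \<open>x < x0\<close>.\<close>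

definition directed_ivl :: "real \<Rightarrow> real \<Rightarrow> real set" where
  "directed_ivl x0 x = (if x0 \<le> x then {x0..<x} else {x..<x0})"

text \<open>The absolute value of the \<open>n\<close>-th monomial divided by \<open>n!\<close>. With values in
  \<^typ>\<open>ennreal\<close> no integrability conditions arise.\<close>

primrec iter_int :: "real measure \<Rightarrow> real \<Rightarrow> nat \<Rightarrow> real \<Rightarrow> ennreal" where
  "iter_int M x0 0 = (\<lambda>x. 1)"
| "iter_int M x0 (Suc n) = (\<lambda>x. \<integral>\<^sup>+t. indicator (directed_ivl x0 x) t * iter_int M x0 n t \<partial>M)"

lemma directed_ivl_mono: "t \<in> directed_ivl x0 x \<Longrightarrow> directed_ivl x0 t \<subseteq> directed_ivl x0 x"
  by (auto simp: directed_ivl_def split: if_splits)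

text \<open>Joint measurability in the point and the end of the interval serves iterated integrals
  whose outer variable is that end.\<close>

lemma pred_directed_ivl [measurable]:
  assumes [measurable]: "f \<in> borel_measurable M" "h \<in> borel_measurable M"
  shows "Measurable.pred M (\<lambda>z. f z \<in> directed_ivl x0 (h z))"
proof -
  have eq: "(\<lambda>z. f z \<in> directed_ivl x0 (h z)) =
      (\<lambda>z. (x0 \<le> h z \<and> x0 \<le> f z \<and> f z < h z) \<or> (h z < x0 \<and> h z \<le> f z \<and> f z < x0))"
    by (auto simp: directed_ivl_def)
  show ?thesis unfolding eq by measurable
qed

lemma borel_measurable_indicator_directed_ivl [measurable]:
  assumes [measurable]: "f \<in> borel_measurable M" "h \<in> borel_measurable M"
  shows "(\<lambda>z. indicator (directed_ivl x0 (h z)) (f z) :: ennreal) \<in> borel_measurable M"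
proof -
  have eq: "(\<lambda>z. indicator (directed_ivl x0 (h z)) (f z) :: ennreal) =
      (\<lambda>z. if f z \<in> directed_ivl x0 (h z) then 1 else 0)"
    by (auto simp: indicator_def)
  show ?thesis unfolding eq by measurable
qed

lemma sets_directed_ivl [measurable]: "directed_ivl x0 x \<in> sets borel"
  by (simp add: directed_ivl_def)

lemma iter_int_measurable [measurable]:
  assumes [measurable_cong]: "sets M = sets borel" and "sigma_finite_measure M"
  shows "iter_int M x0 n \<in> borel_measurable borel"
proof (induction n)
  case (Suc n)
  interpret sigma_finite_measure M by fact
  note Suc [measurable]
  show ?case
    by simp
qed simp

text \<open>Only the domain of the outermost integral depends on the end point, so a case
  distinction replaces induction.\<close>

lemma iter_int_mono:
  assumes "directed_ivl x0 y \<subseteq> directed_ivl x0 x"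
  shows "iter_int M x0 n y \<le> iter_int M x0 n x"
proof (cases n)
  case (Suc m)
  show ?thesis unfolding Suc iter_int.simps
    using assms by (intro nn_integral_mono mult_right_mono) (auto simp: indicator_def)
qed simp

text \<open>Each integration contributes at most the factor
  \<open>emeasure M (directed_ivl x0 x)\<close>, as the inner integral is bounded by its value at
  \<open>x\<close>.\<close>

lemma iter_int_finite:
  assumes [measurable_cong]: "sets M = sets borel"
    and fin: "emeasure M (directed_ivl x0 x) < \<infinity>"
  shows "iter_int M x0 n x < \<infinity>"
proof (induction n)
  case (Suc n)
  have "iter_int M x0 (Suc n) x
      \<le> (\<integral>\<^sup>+t. indicator (directed_ivl x0 x) t * iter_int M x0 n x \<partial>M)"
    unfolding iter_int.simps
    by (intro nn_integral_mono)
      (auto simp: indicator_def intro!: iter_int_mono dest: directed_ivl_mono)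
  also have "\<dots> = emeasure M (directed_ivl x0 x) * iter_int M x0 n x"
    by (subst nn_integral_multc) auto
  also have "\<dots> < \<infinity>"
    using Suc fin by (simp add: ennreal_mult_less_top)
  finally show ?case .
qed simp

text \<open>Integration by parts. Fubini's theorem splits the square
  \<open>directed_ivl x0 x \<times> directed_ivl x0 x\<close> along its diagonal, which is a null set because
  \<open>M\<close> has no atoms.\<close>

lemma iter_int_mult:
  fixes M N :: "real measure"
  assumes M [measurable_cong]: "sets M = sets borel" and sM: "sigma_finite_measure M"
    and N [measurable_cong]: "sets N = sets borel" and sN: "sigma_finite_measure N"
    and atomless: "\<And>s. emeasure M {s} = 0"
  shows "iter_int M x0 (Suc k) x * iter_int N x0 (Suc m) x =
      (\<integral>\<^sup>+s. indicator (directed_ivl x0 x) s * (iter_int M x0 (Suc k) s * iter_int N x0 m s) \<partial>N) +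
      (\<integral>\<^sup>+t. indicator (directed_ivl x0 x) t * (iter_int M x0 k t * iter_int N x0 (Suc m) t) \<partial>M)"
proof -
  interpret M: sigma_finite_measure M by fact
  interpret N: sigma_finite_measure N by fact
  interpret P: pair_sigma_finite N M ..
  let ?I = "\<lambda>x t. indicator (directed_ivl x0 x) t :: ennreal"
  let ?m = "iter_int M x0 k" and ?n = "iter_int N x0 m"
  have [measurable]: "?m \<in> borel_measurable borel" "?n \<in> borel_measurable borel"
    using iter_int_measurable[OF M sM] iter_int_measurable[OF N sN] by auto
  have "iter_int M x0 (Suc k) x * iter_int N x0 (Suc m) x =
      (\<integral>\<^sup>+s. (\<integral>\<^sup>+t. ?I x s * ?n s * (?I x t * ?m t) \<partial>M) \<partial>N)"
    by (simp add: nn_integral_cmult nn_integral_multc mult.commute)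
  also have "\<dots> = (\<integral>\<^sup>+s. (\<integral>\<^sup>+t. ?I x s * ?n s * (?I s t * ?m t)
        + ?I x t * ?m t * (?I t s * ?n s) \<partial>M) \<partial>N)"
  proof (rule nn_integral_cong, rule nn_integral_cong_AE)
    fix s
    have "AE t in M. t \<noteq> s"
      by (rule AE_I[of _ _ "{s}"]) (auto simp: atomless)
    \<comment> \<open>Of two distinct points of \<open>directed_ivl x0 x\<close>, exactly one lies
      in the directed interval of the other. On the diagonal neither does if
      \<open>x0 \<le> x\<close>, and both do if \<open>x < x0\<close>.\<close>
    then show "AE t in M. ?I x s * ?n s * (?I x t * ?m t) =
        ?I x s * ?n s * (?I s t * ?m t) + ?I x t * ?m t * (?I t s * ?n s)"
      by eventually_elim (auto simp: indicator_def directed_ivl_def mult_ac)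
  qed
  also have "\<dots> = (\<integral>\<^sup>+s. (\<integral>\<^sup>+t. ?I x s * ?n s * (?I s t * ?m t) \<partial>M) \<partial>N)
       + (\<integral>\<^sup>+s. (\<integral>\<^sup>+t. ?I x t * ?m t * (?I t s * ?n s) \<partial>M) \<partial>N)"
    by (simp add: nn_integral_add)
  \<comment> \<open>With the order exchanged, the inner integral over \<open>N\<close> becomes
    \<open>iter_int N x0 (Suc m) t\<close>.\<close>
  also have "(\<integral>\<^sup>+s. (\<integral>\<^sup>+t. ?I x t * ?m t * (?I t s * ?n s) \<partial>M) \<partial>N) =
      (\<integral>\<^sup>+t. (\<integral>\<^sup>+s. ?I x t * ?m t * (?I t s * ?n s) \<partial>N) \<partial>M)"
    by (rule P.Fubini'[symmetric]) measurable
  also have "(\<lambda>s. \<integral>\<^sup>+t. ?I x s * ?n s * (?I s t * ?m t) \<partial>M) =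
      (\<lambda>s. ?I x s * (iter_int M x0 (Suc k) s * ?n s))"
    by (subst nn_integral_cmult) (auto simp: mult_ac)
  also have "(\<lambda>t. \<integral>\<^sup>+s. ?I x t * ?m t * (?I t s * ?n s) \<partial>N) =
      (\<lambda>t. ?I x t * (?m t * iter_int N x0 (Suc m) t))"
    by (subst nn_integral_cmult) (auto simp: mult_ac)
  finally show ?thesis .
qed

text \<open>A Leibniz rule for \<open>K\<close> as the sum of \<open>M\<close> and \<open>N\<close>,
  free of binomial coefficients because \<open>iter_int\<close> has the factorials divided out.
  Integrating the formula of one degree against \<open>K\<close> and recombining by parts gives the
  next.\<close>

lemma iter_int_add:
  fixes M N :: "real measure"
  assumes M [measurable_cong]: "sets M = sets borel" and sM: "sigma_finite_measure M"
    and N [measurable_cong]: "sets N = sets borel" and sN: "sigma_finite_measure N"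
    and atomless: "\<And>s. emeasure M {s} = 0"
    and K: "\<And>f. f \<in> borel_measurable borel \<Longrightarrow>
      (\<integral>\<^sup>+t. f t \<partial>K) = (\<integral>\<^sup>+t. f t \<partial>M) + (\<integral>\<^sup>+t. f t \<partial>N)"
  shows "iter_int K x0 n x = (\<Sum>k\<le>n. iter_int M x0 k x * iter_int N x0 (n - k) x)"
proof (induction n arbitrary: x)
  case (Suc n)
  have [measurable]: "iter_int M x0 k \<in> borel_measurable borel"
      "iter_int N x0 k \<in> borel_measurable borel" for k
    using iter_int_measurable[OF M sM] iter_int_measurable[OF N sN] by auto
  define F where
    "F k m t = indicator (directed_ivl x0 x) t * (iter_int M x0 k t * iter_int N x0 m t)" for k m t
  have [measurable]: "F k m \<in> borel_measurable borel" for k m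
    unfolding F_def[abs_def] by measurable
  define IM where "IM k m = (\<integral>\<^sup>+t. F k m t \<partial>M)" for k m
  define IN where "IN k m = (\<integral>\<^sup>+t. F k m t \<partial>N)" for k m
  have parts: "iter_int M x0 (Suc k) x * iter_int N x0 (Suc m) x = IN (Suc k) m + IM k (Suc m)"
    for k m
    unfolding IM_def IN_def F_def by (rule iter_int_mult[OF M sM N sN atomless])
  have "iter_int K x0 (Suc n) x = (\<integral>\<^sup>+t. (\<Sum>k\<le>n. F k (n - k) t) \<partial>K)"
    by (simp only: iter_int.simps Suc sum_distrib_left F_def)
  also have "\<dots> = (\<Sum>k\<le>n. IM k (n - k)) + (\<Sum>k\<le>n. IN k (n - k))"
    by (subst K) (simp_all add: IM_def IN_def nn_integral_sum)
  \<comment> \<open>The \<open>M\<close>-integral with index \<open>k\<close> will join the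
    \<open>N\<close>-integral with index \<open>Suc k\<close>. The unpaired \<open>IM n 0\<close>
    and \<open>IN 0 n\<close> are the two extreme terms of the new sum.\<close>
  also have "(\<Sum>k\<le>n. IM k (n - k)) = (\<Sum>k<n. IM k (n - k)) + IM n 0"
    by (simp flip: lessThan_Suc_atMost)
  also have "(\<Sum>k\<le>n. IN k (n - k)) = IN 0 n + (\<Sum>k<n. IN (Suc k) (n - Suc k))"
    by (subst sum.atMost_shift) simp
  also have "(\<Sum>k<n. IM k (n - k)) + IM n 0 + (IN 0 n + (\<Sum>k<n. IN (Suc k) (n - Suc k))) =
      IN 0 n + ((\<Sum>k<n. IN (Suc k) (n - Suc k) + IM k (n - k)) + IM n 0)"
    by (simp add: sum.distrib ac_simps)
  also have "(\<Sum>k<n. IN (Suc k) (n - Suc k) + IM k (n - k)) =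
      (\<Sum>k<n. iter_int M x0 (Suc k) x * iter_int N x0 (n - k) x)"
  proof (rule sum.cong)
    fix k assume "k \<in> {..<n}"
    \<comment> \<open>Since \<open>k < n\<close>, the subtraction is not truncated and
      \<open>parts\<close> applies with second index \<open>n - Suc k\<close>.\<close>
    then have "n - k = Suc (n - Suc k)" by auto
    then show "IN (Suc k) (n - Suc k) + IM k (n - k) =
        iter_int M x0 (Suc k) x * iter_int N x0 (n - k) x"
      using parts[of k "n - Suc k"] by (simp del: iter_int.simps)
  qed simp
  also have "IM n 0 = iter_int M x0 (Suc n) x * iter_int N x0 0 x"
    by (simp add: IM_def F_def)
  also have "IN 0 n = iter_int M x0 0 x * iter_int N x0 (Suc n) x"
    by (simp add: IN_def F_def)
  also have "iter_int M x0 0 x * iter_int N x0 (Suc n) x +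
      ((\<Sum>k<n. iter_int M x0 (Suc k) x * iter_int N x0 (n - k) x) +
        iter_int M x0 (Suc n) x * iter_int N x0 0 x) =
      (\<Sum>k\<le>Suc n. iter_int M x0 k x * iter_int N x0 (Suc n - k) x)"
    by (subst sum.atMost_shift) (simp add: ac_simps del: iter_int.simps)
  finally show ?case .
qed simp

section \<open>Stieltjes measures\<close>

lemma emeasure_directed_ivl_finite:
  assumes "derivator h"
  shows "emeasure (stieltjes_measure h) (directed_ivl x0 x) < \<infinity>"
proof -
  have "emeasure (stieltjes_measure h) {a..<b} < \<infinity>" for a b
    using emeasure_stieltjes_measure_Ico[OF assms, of a b] by (cases "a < b") auto
  then show ?thesis
    by (simp add: directed_ivl_def)
qed

lemma space_stieltjes_measure [simp]: "space (stieltjes_measure h) = UNIV"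
  by (simp add: stieltjes_measure_def)

lemma UN_Ico_nat: "(\<Union>n::nat. {- real n..<real n}) = UNIV"
proof -
  have "\<exists>n::nat. x \<in> {- real n..<real n}" for x
  proof -
    obtain n where "\<bar>x\<bar> < real n"
      using reals_Archimedean2 by blast
    then show ?thesis
      by (intro exI[of _ n]) auto
  qed
  then show ?thesis by blast
qed

lemma sigma_finite_stieltjes_measure:
  assumes "derivator h"
  shows "sigma_finite_measure (stieltjes_measure h)"
proof
  have "emeasure (stieltjes_measure h) {- real n..<real n} \<noteq> \<infinity>" for n
    using emeasure_stieltjes_measure_Ico[OF assms, of "- real n" "real n"] by (cases "n = 0") auto
  then show "\<exists>A. countable A \<and> A \<subseteq> sets (stieltjes_measure h) \<and>
      \<Union> A = space (stieltjes_measure h) \<and> (\<forall>a\<in>A. emeasure (stieltjes_measure h) a \<noteq> \<infinity>)"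
    using UN_Ico_nat by (intro exI[of _ "range (\<lambda>n::nat. {- real n..<real n})"]) auto
qed

text \<open>All points of \<open>directed_ivl x0 x\<close> lie on the same side of \<open>x0\<close>
  as \<open>x\<close>, so the sign of the integrand is constant; each integration adds one sign and
  one factor of the factorial.\<close>

lemma monomial_eq_iter_int:
  assumes "derivator h"
  shows "monomial h x0 n x =
    (if x0 \<le> x then 1 else -1) ^ n * fact n * enn2real (iter_int (stieltjes_measure h) x0 n x)"
proof (induction n arbitrary: x)
  case (Suc n)
  define M where "M = stieltjes_measure h"
  have M [measurable_cong]: "sets M = sets borel" by (simp add: M_def)
  have sM: "sigma_finite_measure M"
    unfolding M_def by (rule sigma_finite_stieltjes_measure[OF assms])
  have [measurable]: "iter_int M x0 n \<in> borel_measurable borel"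
    by (rule iter_int_measurable[OF M sM])
  \<comment> \<open>\<open>enn2real\<close> maps infinity to 0, so finiteness is what lets
    \<open>ennreal\<close> undo it under the integral.\<close>
  have fin: "iter_int M x0 n t < \<infinity>" for t
    by (rule iter_int_finite[OF M]) (use emeasure_directed_ivl_finite[OF assms] in \<open>simp add: M_def\<close>)
  define s where "s = (if x0 \<le> x then 1 else -1 :: real)"
  have "(LINT t:directed_ivl x0 x|M. monomial h x0 n t) =
      (\<integral>t. s ^ n * fact n * (indicator (directed_ivl x0 x) t * enn2real (iter_int M x0 n t)) \<partial>M)"
    unfolding set_lebesgue_integral_def
    by (rule Bochner_Integration.integral_cong)
      (auto simp: Suc indicator_def directed_ivl_def M_def s_def split: if_splits)
  also have "\<dots> = s ^ n * fact n * (\<integral>t. indicator (directed_ivl x0 x) t * enn2real (iter_int M x0 n t) \<partial>M)"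
    by simp
  also have "(\<integral>t. indicator (directed_ivl x0 x) t * enn2real (iter_int M x0 n t) \<partial>M) =
      enn2real (\<integral>\<^sup>+t. ennreal (indicator (directed_ivl x0 x) t * enn2real (iter_int M x0 n t)) \<partial>M)"
    by (rule integral_eq_nn_integral) auto
  also have "(\<integral>\<^sup>+t. ennreal (indicator (directed_ivl x0 x) t * enn2real (iter_int M x0 n t)) \<partial>M) =
      iter_int M x0 (Suc n) x"
    using fin by (auto intro!: nn_integral_cong simp: indicator_def)
  finally have "(LINT t:directed_ivl x0 x|M. monomial h x0 n t) =
      s ^ n * fact n * enn2real (iter_int M x0 (Suc n) x)" .
  then show ?case
    by (cases "x0 \<le> x")
      (simp_all add: directed_ivl_def M_def s_def algebra_simps del: iter_int.simps)
qed simp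

text \<open>Both sides agree on the intervals \<open>{a..<b}\<close>, which generate the Borel sets,
  are stable under intersection and exhaust the line with finite measure; uniqueness of measures
  does the rest.\<close>

lemma emeasure_stieltjes_add:
  assumes C: "derivator C" and B: "derivator B" and G: "derivator G"
    and add: "\<And>x. G x = C x + B x" and A: "A \<in> sets borel"
  shows "emeasure (stieltjes_measure G) A =
    emeasure (stieltjes_measure C) A + emeasure (stieltjes_measure B) A"
proof -
  define \<mu> where "\<mu> A = emeasure (stieltjes_measure C) A + emeasure (stieltjes_measure B) A" for A
  define N where "N = measure_of UNIV (sets borel) \<mu>"
  have sets_N: "sets N = sets borel"
    unfolding N_def using sets.sets_measure_of_eq[of borel] by simp
  have em_N: "emeasure N A = \<mu> A" if "A \<in> sets borel" for A
    unfolding N_def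
  proof (rule emeasure_measure_of_sigma)
    show "sigma_algebra UNIV (sets (borel :: real measure))"
      using sets.sigma_algebra_axioms[of "borel :: real measure"] by simp
    show "positive (sets borel) \<mu>"
      by (simp add: positive_def \<mu>_def)
    show "countably_additive (sets borel) \<mu>"
      by (rule countably_additiveI)
        (auto simp: \<mu>_def suminf_add[symmetric] suminf_emeasure)
  qed fact
  \<comment> \<open>Both increments must be nonnegative for \<open>ennreal\<close> to be additive on
    them.\<close>
  have mono: "C a \<le> C b" "B a \<le> B b" if "a \<le> b" for a b
    using C B that by (auto simp: derivator_def mono_def)
  have Ico: "emeasure (stieltjes_measure G) {a..<b} = \<mu> {a..<b}" for a b
    using mono[of a b]
    by (cases "a < b") (auto simp: \<mu>_def emeasure_stieltjes_measure_Ico assms ennreal_plus[symmetric]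
        simp del: ennreal_plus)
  have "stieltjes_measure G = N"
  proof (rule measure_eqI_generator_eq[where A = "\<lambda>n::nat. {- real n..<real n}"
        and E = "range (\<lambda>(a, b). {a..<b::real})" and \<Omega> = UNIV])
    show "Int_stable (range (\<lambda>(a, b). {a..<b::real}))"
      by (auto simp: Int_stable_def)
    show "sets (stieltjes_measure G) = sigma_sets UNIV (range (\<lambda>(a, b). {a..<b::real}))"
      by (subst sets_stieltjes_measure, subst borel_eq_atLeastLessThan) simp
    then show "sets N = sigma_sets UNIV (range (\<lambda>(a, b). {a..<b::real}))"
      by (simp add: sets_N)
    show "emeasure (stieltjes_measure G) X = emeasure N X"
      if "X \<in> range (\<lambda>(a, b). {a..<b::real})" for X
      using that by (auto simp: em_N Ico)
    show "emeasure (stieltjes_measure G) {- real n..<real n} \<noteq> \<infinity>" for n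
      using emeasure_stieltjes_measure_Ico[OF G, of "- real n" "real n"] by (cases "n = 0") auto
  qed (use UN_Ico_nat in auto)
  then show ?thesis
    using em_N[OF A] by (simp add: \<mu>_def)
qed

text \<open>Approximation by simple functions carries additivity from sets to integrals.\<close>

lemma nn_integral_add_emeasure:
  assumes [measurable_cong]: "sets K = sets borel" "sets M = sets borel" "sets N = sets borel"
    and add: "\<And>A. A \<in> sets borel \<Longrightarrow> emeasure K A = emeasure M A + emeasure N A"
    and "f \<in> borel_measurable borel"
  shows "(\<integral>\<^sup>+t. f t \<partial>K) = (\<integral>\<^sup>+t. f t \<partial>M) + (\<integral>\<^sup>+t. f t \<partial>N)"
  using \<open>f \<in> borel_measurable borel\<close>
proof (induction rule: borel_measurable_induct)
  case (cong f h)
  then show ?case by (metis UNIV_I ext space_borel)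
next
  case (set A)
  then show ?case by (simp add: add)
next
  case (mult u c)
  then show ?case by (simp add: nn_integral_cmult distrib_left)
next
  case (add u v)
  then show ?case by (simp add: nn_integral_add ac_simps)
next
  case (seq U)
  note seq(1) [measurable]
  have inc: "incseq (\<lambda>i. \<integral>\<^sup>+t. U i t \<partial>L)" for L
    using \<open>incseq U\<close> by (auto simp: mono_def le_fun_def intro!: nn_integral_mono)
  show ?case
    using seq inc
    by (simp add: nn_integral_monotone_convergence_SUP ennreal_SUP_add image_comp SUP_apply)
qed

section \<open>Continuous and discontinuous part of a derivator\<close>

lemma derivator_mono: "derivator g \<Longrightarrow> a \<le> b \<Longrightarrow> g a \<le> g b"
  by (simp add: derivator_def mono_def)

text \<open>The \<open>Lim\<close> in \<open>jump\<close> is meaningful only if the limit exists.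
  Monotonicity ensures this: the limit is the infimum of the values to the right of
  \<open>s\<close>.\<close>

lemma tendsto_jump:
  assumes "derivator g"
  shows "((\<lambda>x. g x - g s) \<longlongrightarrow> jump g s) (at_right s)"
proof -
  have bdd: "bdd_below (g ` {s<..})"
    by (rule bdd_belowI2[of _ "g s"]) (simp add: derivator_mono[OF assms])
  have "(g \<longlongrightarrow> Inf (g ` {s<..})) (at_right s)"
  proof (rule order_tendstoI)
    fix a assume "a < Inf (g ` {s<..})"
    then have "a < g x" if "x > s" for x
      using cInf_lower[OF _ bdd, of "g x"] that by auto
    then show "\<forall>\<^sub>F x in at_right s. a < g x"
      by (intro eventually_at_rightI[of s "s + 1"]) auto
  next
    fix a assume "Inf (g ` {s<..}) < a"
    then obtain y where "y > s" "g y < a"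
      using cInf_less_iff[OF _ bdd, of a] by auto
    then have "g x < a" if "x < y" for x
      using derivator_mono[OF assms, of x y] that by simp
    then show "\<forall>\<^sub>F x in at_right s. g x < a"
      using \<open>y > s\<close> by (intro eventually_at_rightI[of s y]) auto
  qed
  then have "(g \<longlongrightarrow> Lim (at_right s) g) (at_right s)"
    by (simp add: tendsto_Lim)
  then show ?thesis
    unfolding jump_def by (intro tendsto_intros)
qed

text \<open>Continuity from above along the intervals \<open>{s..<d n}\<close>, which have finite
  measure and shrink to \<open>{s}\<close>.\<close>

lemma emeasure_stieltjes_singleton:
  assumes "derivator g"
  shows "emeasure (stieltjes_measure g) {s} = ennreal (jump g s)"
proof -
  define d where "d n = s + 1 / real (Suc n)" for n
  have d: "d n > s" for n by (simp add: d_def)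
  have "d \<longlonglongrightarrow> s + 0"
    unfolding d_def by (intro tendsto_intros LIMSEQ_Suc lim_1_over_n)
  then have lim_d: "filterlim d (at_right s) sequentially"
    using d by (auto simp: filterlim_at intro!: always_eventually)
  have dec: "decseq (\<lambda>n. {s..<d n})"
    by (auto simp: decseq_def d_def intro: less_le_trans frac_le)
  have "(\<lambda>n. emeasure (stieltjes_measure g) {s..<d n}) \<longlonglongrightarrow>
      emeasure (stieltjes_measure g) (\<Inter>n. {s..<d n})"
    using dec d by (intro Lim_emeasure_decseq)
      (auto simp: emeasure_stieltjes_measure_Ico[OF assms])
  also have "(\<Inter>n. {s..<d n}) = {s}"
  proof -
    have "t \<le> s" if "\<forall>n. t < d n" for t
      using that \<open>d \<longlonglongrightarrow> s + 0\<close> by (intro LIMSEQ_le_const[of d]) (auto intro: less_imp_le)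
    then show ?thesis using d by force
  qed
  finally have "(\<lambda>n. ennreal (g (d n) - g s)) \<longlonglongrightarrow> emeasure (stieltjes_measure g) {s}"
    using d by (simp add: emeasure_stieltjes_measure_Ico[OF assms])
  moreover have "(\<lambda>n. ennreal (g (d n) - g s)) \<longlonglongrightarrow> ennreal (jump g s)"
    by (intro tendsto_ennrealI filterlim_compose[OF tendsto_jump[OF assms] lim_d])
  ultimately show ?thesis
    by (rule LIMSEQ_unique)
qed

lemma jump_nonneg:
  assumes "derivator g"
  shows "0 \<le> jump g s"
proof (rule tendsto_lowerbound[OF tendsto_jump[OF assms]])
  show "\<forall>\<^sub>F x in at_right s. 0 \<le> g x - g s"
    by (intro eventually_at_rightI[of s "s + 1"]) (auto simp: derivator_mono[OF assms])
qed simp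

text \<open>Jumps are masses of points, so the sum is the measure of \<open>F\<close>, a subset of
  \<open>{a..<b}\<close>.\<close>

lemma sum_jump_le:
  assumes "derivator g" "finite F" "F \<subseteq> {a..<b}" "a \<le> b"
  shows "sum (jump g) F \<le> g b - g a"
proof (cases "a < b")
  case True
  have "ennreal (sum (jump g) F) = (\<Sum>s\<in>F. emeasure (stieltjes_measure g) {s})"
    using assms by (simp add: emeasure_stieltjes_singleton sum_ennreal jump_nonneg)
  also have "\<dots> = emeasure (stieltjes_measure g) F"
    using assms by (intro emeasure_eq_sum_singleton[symmetric]) auto
  also have "\<dots> \<le> emeasure (stieltjes_measure g) {a..<b}"
    using assms by (intro emeasure_mono) auto
  finally show ?thesis
    using True derivator_mono[OF assms(1), of a b] by (simp add: emeasure_stieltjes_measure_Ico assms)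
qed (use assms in auto)

text \<open>The finite partial sums are bounded by \<open>g b - g a\<close>. Hence the
  \<open>infsum\<close> in \<open>disc_part\<close> is a genuine sum and not the default 0.\<close>

lemma jump_summable:
  assumes "derivator g"
  shows "jump g summable_on {a..<b}"
proof (cases "a \<le> b")
  case True
  then show ?thesis
    using sum_jump_le[OF assms] jump_nonneg[OF assms]
    by (intro nonneg_bdd_above_summable_on) (auto intro!: bdd_aboveI2)
qed simp

lemma disc_part_diff:
  assumes "derivator g" "a \<le> b"
  shows "disc_part g b - disc_part g a = (\<Sum>\<^sub>\<infinity>s\<in>{a..<b}. jump g s)"
proof -
  have split: "(\<Sum>\<^sub>\<infinity>s\<in>{u..<w}. jump g s) =
      (\<Sum>\<^sub>\<infinity>s\<in>{u..<v}. jump g s) + (\<Sum>\<^sub>\<infinity>s\<in>{v..<w}. jump g s)" if "u \<le> v" "v \<le> w" for u v w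
    using that infsum_Un_disjoint[OF jump_summable jump_summable, OF assms(1) assms(1), of u v v w]
    by (simp add: ivl_disj_un)
  show ?thesis
    \<comment> \<open>The three instances treat the origin to the left of, between and to the right
      of \<open>a\<close> and \<open>b\<close>.\<close>
    using assms(2) split[of 0 a b] split[of a 0 b] split[of a b 0]
    by (auto simp: disc_part_def)
qed

text \<open>The first bound makes \<open>disc_part g\<close> monotone, the second
  \<open>cont_part g\<close>; the third removes the atoms of the latter.\<close>

lemma disc_part_diff_bounds:
  assumes "derivator g" "a \<le> b"
  shows "0 \<le> disc_part g b - disc_part g a" "disc_part g b - disc_part g a \<le> g b - g a"
    and "a < b \<Longrightarrow> jump g a \<le> disc_part g b - disc_part g a"
proof -
  show "0 \<le> disc_part g b - disc_part g a"
    unfolding disc_part_diff[OF assms] by (intro infsum_nonneg jump_nonneg[OF assms(1)])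
  show "disc_part g b - disc_part g a \<le> g b - g a"
    unfolding disc_part_diff[OF assms]
    by (intro infsum_le_finite_sums jump_summable sum_jump_le assms)
  show "jump g a \<le> disc_part g b - disc_part g a" if "a < b"
    unfolding disc_part_diff[OF assms]
    using finite_sum_le_infsum[OF jump_summable[OF assms(1)], of "{a}" a b] that
    by (auto simp: jump_nonneg[OF assms(1)])
qed

text \<open>For left continuity, the increments are squeezed between 0 and those of
  \<open>g\<close>.\<close>

lemma derivator_disc_part:
  assumes "derivator g"
  shows "derivator (disc_part g)"
  unfolding derivator_def
proof (intro conjI allI)
  show "mono (disc_part g)"
    using disc_part_diff_bounds(1)[OF assms] by (auto simp: mono_def)
  fix x
  have "((\<lambda>y. g x - g y) \<longlongrightarrow> g x - g x) (at_left x)"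
    using assms by (intro tendsto_intros) (simp add: derivator_def continuous_within)
  moreover have "\<forall>\<^sub>F y in at_left x. 0 \<le> disc_part g x - disc_part g y"
      "\<forall>\<^sub>F y in at_left x. disc_part g x - disc_part g y \<le> g x - g y"
    using disc_part_diff_bounds(1,2)[OF assms, of _ x]
    by (auto intro!: eventually_at_leftI[of "x - 1"] simp del: diff_ge_0_iff_ge)
  ultimately have lim: "((\<lambda>y. disc_part g x - disc_part g y) \<longlongrightarrow> 0) (at_left x)"
    using tendsto_sandwich[of "\<lambda>_. 0" _ _ "\<lambda>y. g x - g y"] by simp
  from tendsto_diff[OF tendsto_const[of "disc_part g x"] lim]
  show "continuous (at_left x) (disc_part g)"
    by (simp add: continuous_within)
qed

lemma derivator_cont_part:
  assumes "derivator g"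
  shows "derivator (cont_part g)"
  unfolding derivator_def
proof (intro conjI allI)
  show "mono (cont_part g)"
    using disc_part_diff_bounds(2)[OF assms] by (auto simp: mono_def cont_part_def algebra_simps)
  fix x
  show "continuous (at_left x) (cont_part g)"
    using assms derivator_disc_part[OF assms]
    unfolding cont_part_def[abs_def] derivator_def by (intro continuous_intros) auto
qed

text \<open>The increment of \<open>disc_part g\<close> to the right of \<open>s\<close> already
  contains \<open>jump g s\<close>, so that of \<open>cont_part g\<close> is at most
  \<open>g x - g s - jump g s\<close>, which tends to 0.\<close>

lemma stieltjes_cont_part_singleton:
  assumes "derivator g"
  shows "emeasure (stieltjes_measure (cont_part g)) {s} = 0"
proof -
  have "jump (cont_part g) s \<le> jump g s - jump g s"
  proof (rule tendsto_le[OF _ _ tendsto_jump[OF derivator_cont_part[OF assms]]])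
    show "((\<lambda>x. g x - g s - jump g s) \<longlongrightarrow> jump g s - jump g s) (at_right s)"
      by (intro tendsto_diff tendsto_jump assms tendsto_const)
    show "\<forall>\<^sub>F x in at_right s. cont_part g x - cont_part g s \<le> g x - g s - jump g s"
      using disc_part_diff_bounds(3)[OF assms, of s]
      by (intro eventually_at_rightI[of s "s + 1"])
        (auto simp: cont_part_def algebra_simps)
  qed simp
  then show ?thesis
    using emeasure_stieltjes_singleton[OF derivator_cont_part[OF assms]] by (simp add: ennreal_neg)
qed

section \<open>Exponential series\<close>

text \<open>Up to a power of \<open>c\<close> and a sign, each term is a nonnegative real, so
  passing to norms loses nothing in the convolution. The first identity serves the value of the
  series, the second its convergence.\<close>

lemma exp_term_add:
  fixes c :: "'a::{real_normed_field,banach}"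
  assumes "derivator g"
  shows "exp_term g c x0 x n =
    (\<Sum>k\<le>n. exp_term (cont_part g) c x0 x k * exp_term (disc_part g) c x0 x (n - k))"
    and "norm (exp_term g c x0 x n) =
    (\<Sum>k\<le>n. norm (exp_term (cont_part g) c x0 x k) * norm (exp_term (disc_part g) c x0 x (n - k)))"
proof -
  note C = derivator_cont_part[OF assms] and B = derivator_disc_part[OF assms]
  define s where "s = (if x0 \<le> x then 1 else -1 :: real)"
  define p where "p h k = enn2real (iter_int (stieltjes_measure h) x0 k x)" for h k
  have term_eq: "exp_term h c x0 x k = (c * of_real s) ^ k * of_real (p h k)" if "derivator h" for h k
    by (simp add: exp_term_def monomial_eq_iter_int[OF that] p_def s_def power_mult_distrib)
  have norm_term: "norm (exp_term h c x0 x k) = norm c ^ k * p h k" if "derivator h" for h k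
    by (simp add: term_eq[OF that] norm_mult norm_power p_def s_def)
  have fin: "iter_int (stieltjes_measure h) x0 k x < \<infinity>" if "derivator h" for h k
    by (intro iter_int_finite emeasure_directed_ivl_finite that) simp
  have "iter_int (stieltjes_measure g) x0 n x = (\<Sum>k\<le>n.
      iter_int (stieltjes_measure (cont_part g)) x0 k x *
      iter_int (stieltjes_measure (disc_part g)) x0 (n - k) x)"
    by (intro iter_int_add sigma_finite_stieltjes_measure C B stieltjes_cont_part_singleton assms
        nn_integral_add_emeasure emeasure_stieltjes_add) (auto simp: cont_part_def)
  then have p: "p g n = (\<Sum>k\<le>n. p (cont_part g) k * p (disc_part g) (n - k))"
    \<comment> \<open>\<open>enn2real\<close> is additive only on finite values.\<close>
    unfolding p_def using fin[OF C] fin[OF B]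
    by (simp add: enn2real_sum ennreal_mult_less_top enn2real_mult)
  show "exp_term g c x0 x n =
    (\<Sum>k\<le>n. exp_term (cont_part g) c x0 x k * exp_term (disc_part g) c x0 x (n - k))"
    unfolding term_eq[OF assms] term_eq[OF C] term_eq[OF B] p of_real_sum sum_distrib_left
    by (intro sum.cong) (auto simp: mult_ac simp flip: power_add)
  show "norm (exp_term g c x0 x n) =
    (\<Sum>k\<le>n. norm (exp_term (cont_part g) c x0 x k) * norm (exp_term (disc_part g) c x0 x (n - k)))"
    unfolding norm_term[OF assms] norm_term[OF C] norm_term[OF B] p sum_distrib_left
    by (intro sum.cong) (auto simp: mult_ac simp flip: power_add)
qed

text \<open>Absolute terms grow with the directed interval, so the series at \<open>y\<close> is
  dominated by that at \<open>x\<close>.\<close>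

lemma exp_series_abs_conv_directed_ivl:
  assumes "derivator h" "directed_ivl x0 y \<subseteq> directed_ivl x0 x" "exp_series_abs_conv h c x0 x"
  shows "exp_series_abs_conv h c x0 y"
  unfolding exp_series_abs_conv_def
proof (rule summable_comparison_test')
  show "summable (\<lambda>n. norm (exp_term h c x0 x n))"
    using assms(3) by (simp add: exp_series_abs_conv_def)
  fix n :: nat
  have "iter_int (stieltjes_measure h) x0 n x < \<infinity>"
    by (intro iter_int_finite emeasure_directed_ivl_finite assms) simp
  then have "enn2real (iter_int (stieltjes_measure h) x0 n y)
      \<le> enn2real (iter_int (stieltjes_measure h) x0 n x)"
    using iter_int_mono[OF assms(2)] by (intro enn2real_mono) auto
  then show "norm (norm (exp_term h c x0 y n)) \<le> norm (exp_term h c x0 x n)"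
    by (auto simp: exp_term_def monomial_eq_iter_int[OF assms(1)] norm_mult norm_divide norm_power
        abs_mult intro!: mult_left_mono)
qed

text \<open>The set of all convergence points is itself an interval, hence the greatest one.\<close>

lemma conv_interval_eq:
  assumes "derivator h"
  shows "conv_interval h c x0 = {x. exp_series_abs_conv h c x0 x}"
  unfolding conv_interval_def
proof (rule Greatest_equality)
  show "is_interval {x. exp_series_abs_conv h c x0 x} \<and>
      (\<forall>x\<in>{x. exp_series_abs_conv h c x0 x}. exp_series_abs_conv h c x0 x)"
  proof (clarsimp simp: is_interval_1)
    fix a b x
    assume "exp_series_abs_conv h c x0 a" "exp_series_abs_conv h c x0 b" "a \<le> x" "x \<le> b"
    then show "exp_series_abs_conv h c x0 x"
      \<comment> \<open>Compare with \<open>b\<close> if \<open>x0 \<le> x\<close>, and with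
        \<open>a\<close> otherwise.\<close>
      using exp_series_abs_conv_directed_ivl[OF assms, of x0 x a]
        exp_series_abs_conv_directed_ivl[OF assms, of x0 x b]
      by (cases "x0 \<le> x") (auto simp: directed_ivl_def)
  qed
qed auto

theorem proposition5p6:
  fixes g :: "real \<Rightarrow> real" and c :: "'a::{real_normed_field,banach}" and x0 :: real
  assumes "derivator g" and "c \<noteq> 0"
  shows "(\<forall>x. exp_series_abs_conv g c x0 x \<longleftrightarrow>
              exp_series_abs_conv (cont_part g) c x0 x \<and>
              exp_series_abs_conv (disc_part g) c x0 x) \<and>
         (\<forall>x\<in>conv_interval g c x0.
              gexp g c x0 x = gexp (cont_part g) c x0 x * gexp (disc_part g) c x0 x)"
proof -
  note conv_def = exp_series_abs_conv_def
  have conv: "exp_series_abs_conv g c x0 x \<longleftrightarrow>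
      exp_series_abs_conv (cont_part g) c x0 x \<and> exp_series_abs_conv (disc_part g) c x0 x" for x
  proof -
    let ?a = "\<lambda>n. norm (exp_term g c x0 x n)"
    let ?b = "\<lambda>n. norm (exp_term (cont_part g) c x0 x n)"
    let ?d = "\<lambda>n. norm (exp_term (disc_part g) c x0 x n)"
    have a: "?a n = (\<Sum>k\<le>n. ?b k * ?d (n - k))" for n
      by (rule exp_term_add(2)[OF assms(1)])
    have 0: "?b 0 = 1" "?d 0 = 1" by (simp_all add: exp_term_def)
    \<comment> \<open>These are the summands \<open>k = n\<close> and \<open>k = 0\<close> of the
      convolution, whose other factor is 1.\<close>
    have "?b n \<le> ?a n" "?d n \<le> ?a n" for n
      using member_le_sum[of n "{..n}" "\<lambda>k. ?b k * ?d (n - k)"]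
        member_le_sum[of 0 "{..n}" "\<lambda>k. ?b k * ?d (n - k)"] 0
      unfolding a by auto
    then have "summable ?b \<and> summable ?d" if "summable ?a"
      using that by (auto intro: summable_comparison_test')
    moreover have "summable ?a" if "summable ?b" "summable ?d"
      using summable_Cauchy_product[of ?b ?d] that by (simp add: a)
    ultimately show ?thesis unfolding conv_def by blast
  qed
  moreover have "gexp g c x0 x = gexp (cont_part g) c x0 x * gexp (disc_part g) c x0 x"
    if "exp_series_abs_conv g c x0 x" for x
    \<comment> \<open>By \<open>conv\<close> both factors converge absolutely, so their product is
      the sum of the convolution, whose terms are those of \<open>g\<close>.\<close>
    using that Cauchy_product[of "exp_term (cont_part g) c x0 x" "exp_term (disc_part g) c x0 x"]
    unfolding conv unfolding conv_def gexp_def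
    by (simp add: exp_term_add(1)[OF assms(1), abs_def])
  ultimately show ?thesis
    by (simp add: conv_interval_eq[OF assms(1)])
qed

end
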